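(* Let $n\ge2$ be an integer, let $u_0<u_1$ be real numbers, and let $a_0,a_1,k_0>0$ and $d_1\ge0$. Then for all sufficiently small values of the product $Ak_1>0$ (where $A>0$, $k_1>0$) the function $$E(\xi_1)=-k_0(u_1-u_0)\ln G(\xi_1/a_0)+Ak_1G(\xi_1/a_1)+\frac{d_1\xi_1^2}{4},\quad \xi_1\in(0,+\infty),$$ is not convex on $(0,+\infty)$.
   Context: $G(y)=\int_y^{+\infty}s^{1-n}e^{-s^2/4}\,ds$ for $y>0$. "For all sufficiently small $Ak_1>0$" means: there is $\varepsilon>0$, depending on $n,u_0,u_1,a_0,a_1,k_0,d_1$, such that the assertion holds whenever $0<Ak_1<\varepsilon$. *)

theory Defs
  imports "HOL-Analysis.Analysis"
begin

definition G :: "nat \<Rightarrow> real \<Rightarrow> real" where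
  "G n y = integral {y..} (\<lambda>s. s powi (1 - int n) * exp (- (s\<^sup>2 / 4)))"

definition E ::
  "nat \<Rightarrow> real \<Rightarrow> real \<Rightarrow> real \<Rightarrow> real \<Rightarrow> real \<Rightarrow> real \<Rightarrow> real \<Rightarrow> real \<Rightarrow> real \<Rightarrow> real" where
  "E n u0 u1 a0 a1 k0 k1 d1 A \<xi> =
     - k0 * (u1 - u0) * ln (G n (\<xi> / a0)) + A * k1 * G n (\<xi> / a1) + d1 * \<xi>\<^sup>2 / 4"

end

(* At A k_1 = 0 the function tends to -\<infinity> at 0, because G blows up there; a convex function on
   (0,\<infinity>) stays above the secant line through (1, f 1) and (2, f 2) on (0,1), hence is bounded below
   near 0. So convexity fails at some fixed triple x < 1 < 2, with a strict inequality, which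
   survives adding a sufficiently small multiple of any other function. *)
theory Submission
  imports Defs
begin

lemma continuous_on_G_integrand:
  assumes "y > 0"
  shows "continuous_on {y..} (\<lambda>s::real. s powi k * exp (- (s\<^sup>2 / 4)))"
  using assms by (intro continuous_intros) auto

text \<open>On \<open>{y..}\<close> the power factor is at most its value at \<open>y\<close>, and
  the Gaussian factor is dominated by a multiple of \<open>exp (- s)\<close>. Since
  \<open>integral\<close> defaults to 0 on non-integrable functions, bounding \<open>G\<close> from
  below relies on this.\<close>

lemma G_integrand_integrable:
  assumes "n \<ge> 1" "y > 0"
  shows "(\<lambda>s::real. s powi (1 - int n) * exp (- (s\<^sup>2 / 4))) integrable_on {y..}"
proof -
  obtain m where n: "n = Suc m"
    using assms(1) by (cases n) auto
  let ?C = "inverse (y ^ m) * exp 1"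
  show ?thesis
  proof (rule measurable_bounded_by_integrable_imp_integrable)
    show "(\<lambda>s::real. s powi (1 - int n) * exp (- (s\<^sup>2 / 4))) \<in> borel_measurable (lebesgue_on {y..})"
      by (intro continuous_imp_measurable_on_sets_lebesgue continuous_on_G_integrand assms) auto
    show "(\<lambda>s. ?C * exp (- 1 * s)) integrable_on {y..}"
      using has_integral_exp_minus_to_infinity[of 1 y] by (intro integrable_on_mult_right) auto
    fix s assume "s \<in> {y..}"
    then have s: "y \<le> s" "0 < s"
      using assms by auto
    \<comment> \<open>Expanding the square gives - s^2/4 \<le> 1 - s, whence the factor
      \<open>exp 1\<close> in \<open>?C\<close>.\<close>
    have "0 \<le> (s / 2 - 1)\<^sup>2"
      by simp
    then have "exp (- (s\<^sup>2 / 4)) \<le> exp 1 * exp (- 1 * s)"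
      by (simp add: power2_eq_square algebra_simps flip: exp_add)
    moreover have "inverse (s ^ m) \<le> inverse (y ^ m)"
      using s assms by (intro le_imp_inverse_le power_mono) auto
    ultimately have "inverse (s ^ m) * exp (- (s\<^sup>2 / 4)) \<le> inverse (y ^ m) * (exp 1 * exp (- 1 * s))"
      using assms by (intro mult_mono) auto
    then show "norm (s powi (1 - int n) * exp (- (s\<^sup>2 / 4))) \<le> ?C * exp (- 1 * s)"
      using s by (simp add: n power_int_minus abs_mult mult.assoc)
  qed auto
qed

text \<open>Discard the tail beyond 1 of the nonnegative integrand. On \<open>{y..1}\<close> the
  exponential is at least \<open>exp (- 1 / 4)\<close> and, as n - 1 \<ge> 1, the power is at least
  1/s, whose integral is \<open>- ln y\<close>.\<close>

lemma G_ge_ln: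
  assumes "n \<ge> 2" "0 < y" "y \<le> 1"
  shows "exp (- 1 / 4) * - ln y \<le> G n y"
proof -
  let ?f = "\<lambda>s::real. s powi (1 - int n) * exp (- (s\<^sup>2 / 4))"
  obtain m where n: "n = Suc (Suc m)"
    using assms(1) by (metis add_2_eq_Suc le_Suc_ex)
  have int1: "?f integrable_on {y..1}"
    using assms by (intro integrable_continuous_real continuous_on_subset[OF continuous_on_G_integrand]) auto
  have "((\<lambda>s. inverse s) has_integral (ln 1 - ln y)) {y..1}"
    using assms
    by (intro fundamental_theorem_of_calculus)
      (auto simp flip: has_real_derivative_iff_has_vector_derivative intro!: derivative_eq_intros
        simp: field_simps)
  then have "((\<lambda>s. exp (- 1 / 4) * inverse s) has_integral (exp (- 1 / 4) * - ln y)) {y..1}"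
    by (intro has_integral_mult_right) simp
  then have "exp (- 1 / 4) * - ln y \<le> integral {y..1} ?f"
  proof (rule has_integral_le[OF _ integrable_integral[OF int1]])
    fix s assume "s \<in> {y..1}"
    then have s: "0 < s" "s \<le> 1"
      using assms by auto
    have "s ^ Suc m \<le> s ^ 1"
      using s by (intro power_decreasing) auto
    then have "inverse s \<le> inverse (s ^ Suc m)"
      using s by (intro le_imp_inverse_le) auto
    moreover have "exp (- 1 / 4) \<le> exp (- (s\<^sup>2 / 4))"
      using s by (simp add: power_le_one)
    ultimately have "exp (- 1 / 4) * inverse s \<le> exp (- (s\<^sup>2 / 4)) * inverse (s ^ Suc m)"
      using s by (intro mult_mono) auto
    moreover have "1 - int n = - int (Suc m)"
      by (simp add: n)
    ultimately show "exp (- 1 / 4) * inverse s \<le> ?f s"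
      by (simp only: power_int_minus power_int_of_nat mult.commute)
  qed
  also have "\<dots> \<le> integral {y..} ?f"
    using assms int1 G_integrand_integrable[of n y]
    by (intro integral_subset_le) (auto intro!: mult_nonneg_nonneg zero_le_power_int)
  finally show ?thesis
    by (simp add: G_def)
qed

lemma filterlim_G_at_right_0:
  assumes "n \<ge> 2"
  shows "filterlim (G n) at_top (at_right 0)"
proof (rule filterlim_at_top_mono)
  show "filterlim (\<lambda>y::real. exp (- 1 / 4) * - ln y) at_top (at_right 0)"
    by (intro filterlim_tendsto_pos_mult_at_top[OF tendsto_const])
      (auto intro: filterlim_compose[OF filterlim_uminus_at_top_at_bot ln_at_0])
  show "\<forall>\<^sub>F y in at_right 0. exp (- 1 / 4) * - ln y \<le> G n y"
    unfolding eventually_at_right_field using G_ge_ln[OF assms] by (intro exI[of _ 1]) auto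
qed

lemma not_convex_on_small_perturbation:
  fixes h g :: "real \<Rightarrow> real"
  assumes "filterlim h at_bot (at_right 0)"
  shows "\<exists>\<epsilon>>0. \<forall>p. 0 < p \<and> p < \<epsilon> \<longrightarrow> \<not> convex_on {0<..} (\<lambda>x. h x + p * g x)"
proof -
  \<comment> \<open>Half of this bound is - |h 1| - |h 2|/2. The weight of \<open>x\<close> below is
    at least 1/2 and that of 2 at most 1/2, so the secant value at 1 falls below - |h 1|.\<close>
  have "\<forall>\<^sub>F x in at_right 0. h x < - 2 * \<bar>h 1\<bar> - \<bar>h 2\<bar>"
    using assms by (auto simp: filterlim_at_bot_dense)
  moreover have "\<forall>\<^sub>F x in at_right (0::real). 0 < x \<and> x < 1"
    by (auto simp: eventually_at_right_field intro!: exI[of _ 1])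
  ultimately have "\<forall>\<^sub>F x in at_right 0. h x < - 2 * \<bar>h 1\<bar> - \<bar>h 2\<bar> \<and> 0 < x \<and> x < 1"
    by (rule eventually_conj)
  then obtain x where x: "h x < - 2 * \<bar>h 1\<bar> - \<bar>h 2\<bar>" "0 < x" "x < 1"
    using eventually_happens trivial_limit_at_right_real by blast
  \<comment> \<open>The weight of \<open>x\<close> when 1 is written as a convex combination of
    \<open>x\<close> and 2.\<close>
  define t where "t = 1 / (2 - x)"
  have t_mult: "t * (2 - x) = 1"
    using x by (simp add: t_def)
  have t: "1 / 2 \<le> t" "t \<le> 1"
    using x by (auto simp: t_def field_simps)
  have convex_comb: "t * x + (2 - t * 2) = 1"
    using t_mult by (simp add: algebra_simps)
  \<comment> \<open>\<open>\<delta>\<close> is the amount by which \<open>h\<close> violates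
    convexity at the triple; convexity of h + p g would force \<delta> \<le> p K.\<close>
  define \<delta> where "\<delta> = h 1 - (t * h x + (1 - t) * h 2)"
  define K where "K = t * g x + (1 - t) * g 2 - g 1"
  have "t * h x \<le> 1 / 2 * h x"
    using t x by (intro mult_right_mono_neg) auto
  moreover have "(1 - t) * h 2 \<le> (1 - t) * \<bar>h 2\<bar>"
    using t by (intro mult_left_mono) auto
  moreover have "(1 - t) * \<bar>h 2\<bar> \<le> 1 / 2 * \<bar>h 2\<bar>"
    using t by (intro mult_right_mono) auto
  ultimately have \<delta>: "\<delta> > 0"
    using x by (simp add: \<delta>_def)
  show ?thesis
  \<comment> \<open>The denominator is positive and at least \<open>K\<close>, whatever the sign of
    \<open>K\<close>, so p K < \<delta>.\<close>
  proof (intro exI[of _ "\<delta> / (1 + \<bar>K\<bar>)"] conjI allI impI notI)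
    show "0 < \<delta> / (1 + \<bar>K\<bar>)"
      using \<delta> by simp
    fix p assume p: "0 < p \<and> p < \<delta> / (1 + \<bar>K\<bar>)"
    assume "convex_on {0<..} (\<lambda>x. h x + p * g x)"
    \<comment> \<open>\<open>convex_onD\<close> puts its parameter on the second point, hence
      \<open>1 - t\<close>.\<close>
    from convex_onD[OF this, of "1 - t" x 2]
    have "h 1 + p * g 1 \<le> t * (h x + p * g x) + (1 - t) * (h 2 + p * g 2)"
      using t x by (simp add: convex_comb)
    then have "\<delta> \<le> p * K"
      by (simp add: \<delta>_def K_def algebra_simps)
    also have "\<dots> \<le> p * (1 + \<bar>K\<bar>)"
      using p by (intro mult_left_mono) auto
    also have "\<dots> < \<delta>"
      using p by (simp add: pos_less_divide_eq)
    finally show False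
      by simp
  qed
qed

theorem mainTheorem8:
  fixes n :: nat and u0 u1 a0 a1 k0 d1 :: real
  assumes "n \<ge> 2" and "u0 < u1"
    and "a0 > 0" and "a1 > 0" and "k0 > 0" and "d1 \<ge> 0"
  shows "\<exists>\<epsilon>>0. \<forall>A>0. \<forall>k1>0. A * k1 < \<epsilon> \<longrightarrow>
           \<not> convex_on {0<..} (E n u0 u1 a0 a1 k0 k1 d1 A)"
proof -
  let ?c = "k0 * (u1 - u0)"
  \<comment> \<open>This is \<open>E\<close> at A k1 = 0, written as a negative so that its limit
    follows from a sum of a null term and one tending to +\<infinity>.\<close>
  define h where "h \<xi> = - (- (d1 * \<xi>\<^sup>2 / 4) + ?c * ln (G n (\<xi> / a0)))" for \<xi>
  have "filterlim (\<lambda>\<xi>. \<xi> / a0) (at_right 0) (at_right 0)"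
    using \<open>a0 > 0\<close> eventually_at_right_less[of "0::real"]
    by (auto simp: filterlim_at intro!: tendsto_eq_intros elim!: eventually_mono)
  then have "filterlim (\<lambda>\<xi>. ln (G n (\<xi> / a0))) at_top (at_right 0)"
    using \<open>n \<ge> 2\<close>
    by (intro filterlim_compose[OF ln_at_top] filterlim_compose[OF filterlim_G_at_right_0])
  then have "filterlim (\<lambda>\<xi>. ?c * ln (G n (\<xi> / a0))) at_top (at_right 0)"
    using assms by (intro filterlim_tendsto_pos_mult_at_top[OF tendsto_const]) auto
  moreover have "((\<lambda>\<xi>. - (d1 * \<xi>\<^sup>2 / 4)) \<longlongrightarrow> 0) (at_right 0)"
    by (auto intro!: tendsto_eq_intros)
  ultimately have "filterlim (\<lambda>\<xi>. - (d1 * \<xi>\<^sup>2 / 4) + ?c * ln (G n (\<xi> / a0))) at_top (at_right 0)"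
    by (rule filterlim_tendsto_add_at_top[rotated])
  then have "filterlim h at_bot (at_right 0)"
    unfolding h_def by (rule filterlim_compose[OF filterlim_uminus_at_bot_at_top])
  from not_convex_on_small_perturbation[OF this, of "\<lambda>\<xi>. G n (\<xi> / a1)"]
  obtain \<epsilon> where "\<epsilon> > 0" and
    \<epsilon>: "\<And>p. 0 < p \<Longrightarrow> p < \<epsilon> \<Longrightarrow> \<not> convex_on {0<..} (\<lambda>\<xi>. h \<xi> + p * G n (\<xi> / a1))"
    by blast
  \<comment> \<open>\<open>A\<close> and \<open>k1\<close> enter only through p = A k1, so one
    \<open>\<epsilon>\<close> serves all pairs.\<close>
  have "E n u0 u1 a0 a1 k0 k1 d1 A = (\<lambda>\<xi>. h \<xi> + A * k1 * G n (\<xi> / a1))" for A k1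
    by (simp add: E_def h_def fun_eq_iff)
  then show ?thesis
    using \<open>\<epsilon> > 0\<close> \<epsilon> by (intro exI[of _ \<epsilon>]) (simp add: mult_pos_pos)
qed

end
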